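(* Let $(\mathcal{V},\mathcal{TV},\mathcal{L},\ell_0,\mathcal{T})$ be an integer program, let $\mathcal{RB}$ be a global runtime bound, $\mathcal{SB}$ a size bound, $\emptyset\ne\mathcal{T}'_>\subseteq\mathcal{T}'\subseteq\mathcal{T}\setminus\mathcal{T}_0$, and let $f:\mathcal{E}_{\mathcal{T}'}\to\mathcal{B}$ be a local runtime bound for $\mathcal{T}'_>$ w.r.t. $\mathcal{T}'$. Define $\mathcal{RB}'(t)=\mathcal{RB}(t)$ for $t\in\mathcal{T}\setminus\mathcal{T}'_>$ and $\mathcal{RB}'(t)=\sum_{r\in\mathcal{E}_{\mathcal{T}'}}\mathcal{RB}(r)\cdot\big(f(r)[v/\mathcal{SB}(r,v)\mid v\in\mathcal{V}]\big)$ for $t\in\mathcal{T}'_>$. Then $\mathcal{RB}'$ is a global runtime bound.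
   Context: Bounds $\mathcal{B}$: smallest set containing $\mathbb{R}_{\ge0}\cup\{\omega\}$ and the program variables, closed under $+,\cdot,k^b,\log_k(\max\{1,b\}),\max$ ($k>1$ real); all bounds are weakly monotonically increasing. An integer program $(\mathcal{V},\mathcal{TV},\mathcal{L},\ell_0,\mathcal{T})$: finite disjoint sets of program variables $\mathcal{V}$ and temporary variables $\mathcal{TV}$, finite locations $\mathcal{L}$ with initial $\ell_0$, finite transitions $(\ell,\varphi,\eta,\ell')$ with $\ell'\ne\ell_0$, guard $\varphi$ a propositional formula built with $\wedge,\vee$ from atoms $p_1<p_2$, $p_i\in\mathbb{Z}[\mathcal{V}\cup\mathcal{TV}]$, update $\eta:\mathcal{V}\to\mathbb{Z}[\mathcal{V}\cup\mathcal{TV}]$; $\mathcal{T}_0$ are the transitions starting in $\ell_0$. States $\sigma:\mathcal{V}\cup\mathcal{TV}\to\mathbb{Z}$ ($\Sigma$ the set of states), $|\sigma|(v)=|\sigma(v)|$; $(\ell,\sigma)\to_t(\ell',\sigma')$ iff $t=(\ell,\varphi,\eta,\ell')$, $\sigma(\varphi)$ holds and $\sigma'(v)=\sigma(\eta(v))$ for $v\in\mathcal{V}$; $\to_{\mathcal{T}'}$ is the union over $t\in\mathcal{T}'$. $\mathcal{RB}:\mathcal{T}\to\mathcal{B}$ is a global runtime bound if for all $t$ and $\sigma_0$: $|\sigma_0|(\mathcal{RB}(t))\ge\sup\{k\mid\exists(\ell',\sigma').(\ell_0,\sigma_0)(\to^*_{\mathcal{T}}\circ\to_t)^k(\ell',\sigma')\}$.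 $\mathcal{SB}:\mathcal{T}\times\mathcal{V}\to\mathcal{B}$ is a size bound if $|\sigma_0|(\mathcal{SB}(t,v))\ge\sup\{|\sigma'(v)|\mid\exists\ell'.(\ell_0,\sigma_0)(\to^*_{\mathcal{T}}\circ\to_t)(\ell',\sigma')\}$. Entry transitions $\mathcal{E}_{\mathcal{T}'}$: the $t=(\ell',\_,\_,\ell)\in\mathcal{T}\setminus\mathcal{T}'$ such that some transition of $\mathcal{T}'$ starts in $\ell$. A local runtime bound for $\mathcal{T}'_>$ w.r.t. $\mathcal{T}'$ is $f:\mathcal{E}_{\mathcal{T}'}\to\mathcal{B}$ with, for all $t\in\mathcal{T}'_>$, $r=(\ell',\_,\_,\ell)\in\mathcal{E}_{\mathcal{T}'}$ and $\sigma\in\Sigma$: $|\sigma|(f(r))\ge\sup\{k\mid\exists\sigma',(\ell'',\sigma'').(\ell',\sigma')\to_r(\ell,\sigma)(\to^*_{\mathcal{T}'}\circ\to_t)^k(\ell'',\sigma'')\}$. $b[v/b_v\mid v\in\mathcal{V}]$ replaces each variable $v$ in $b$ by $b_v$. *)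

theory Defs
  imports "HOL-Library.Poly_Mapping" "HOL-Library.FuncSet"
    "HOL-Library.Extended_Nonnegative_Real" Complex_Main
begin

section \<open>Bounds\<close>

text \<open>
  The type \<^typ>\<open>ennreal\<close> of constants and values is the set of non-negative reals extended by
  \<open>\<omega>\<close>, which is \<^term>\<open>\<infinity> :: ennreal\<close>; in particular \<open>0 \<cdot> \<omega> = 0\<close> and the supremum
  of the empty set is \<open>0\<close>.  The term \<open>BLog k b\<close> stands for \<open>log\<^sub>k (max {1, b})\<close>.
\<close>

datatype 'v bound =
    BConst ennreal
  | BVar 'v
  | BAdd "'v bound" "'v bound"
  | BMult "'v bound" "'v bound"
  | BExp real "'v bound"
  | BLog real "'v bound"
  | BMax "'v bound" "'v bound"

inductive_set bounds :: "'v set \<Rightarrow> 'v bound set" for V :: "'v set" where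
  BConst: "BConst c \<in> bounds V"
| BVar: "v \<in> V \<Longrightarrow> BVar v \<in> bounds V"
| BAdd: "b \<in> bounds V \<Longrightarrow> b' \<in> bounds V \<Longrightarrow> BAdd b b' \<in> bounds V"
| BMult: "b \<in> bounds V \<Longrightarrow> b' \<in> bounds V \<Longrightarrow> BMult b b' \<in> bounds V"
| BExp: "k > 1 \<Longrightarrow> b \<in> bounds V \<Longrightarrow> BExp k b \<in> bounds V"
| BLog: "k > 1 \<Longrightarrow> b \<in> bounds V \<Longrightarrow> BLog k b \<in> bounds V"
| BMax: "b \<in> bounds V \<Longrightarrow> b' \<in> bounds V \<Longrightarrow> BMax b b' \<in> bounds V"

primrec eval_bound :: "('v \<Rightarrow> ennreal) \<Rightarrow> 'v bound \<Rightarrow> ennreal" where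
  "eval_bound s (BConst c) = c"
| "eval_bound s (BVar v) = s v"
| "eval_bound s (BAdd b b') = eval_bound s b + eval_bound s b'"
| "eval_bound s (BMult b b') = eval_bound s b * eval_bound s b'"
| "eval_bound s (BExp k b) =
    (if eval_bound s b = \<infinity> then \<infinity> else ennreal (k powr enn2real (eval_bound s b)))"
| "eval_bound s (BLog k b) =
    (if eval_bound s b = \<infinity> then \<infinity> else ennreal (log k (max 1 (enn2real (eval_bound s b)))))"
| "eval_bound s (BMax b b') = max (eval_bound s b) (eval_bound s b')"

primrec subst_bound :: "'v bound \<Rightarrow> ('v \<Rightarrow> 'v bound) \<Rightarrow> 'v bound" where
  "subst_bound (BConst c) \<theta> = BConst c"
| "subst_bound (BVar v) \<theta> = \<theta> v"
| "subst_bound (BAdd b b') \<theta> = BAdd (subst_bound b \<theta>) (subst_bound b' \<theta>)"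
| "subst_bound (BMult b b') \<theta> = BMult (subst_bound b \<theta>) (subst_bound b' \<theta>)"
| "subst_bound (BExp k b) \<theta> = BExp k (subst_bound b \<theta>)"
| "subst_bound (BLog k b) \<theta> = BLog k (subst_bound b \<theta>)"
| "subst_bound (BMax b b') \<theta> = BMax (subst_bound b \<theta>) (subst_bound b' \<theta>)"

text \<open>
  Bounds are syntactic, so a finite sum of bounds needs an order of the summands; it is chosen
  arbitrarily and has no influence on the value of the sum (see \<open>eval_sum_bound\<close>).
\<close>

definition sum_bound :: "('a \<Rightarrow> 'v bound) \<Rightarrow> 'a set \<Rightarrow> 'v bound" where
  "sum_bound g A = foldr (\<lambda>a b. BAdd (g a) b) (SOME xs. distinct xs \<and> set xs = A) (BConst 0)"

lemma eval_sum_bound: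
  assumes "finite A"
  shows "eval_bound s (sum_bound g A) = (\<Sum>a\<in>A. eval_bound s (g a))"
proof -
  define xs where "xs = (SOME xs. distinct xs \<and> set xs = A)"
  have "\<exists>xs. distinct xs \<and> set xs = A"
    using finite_distinct_list[OF assms] by blast
  then have xs: "distinct xs \<and> set xs = A"
    unfolding xs_def by (rule someI_ex)
  have "eval_bound s (foldr (\<lambda>a b. BAdd (g a) b) ys (BConst 0)) = (\<Sum>a\<leftarrow>ys. eval_bound s (g a))"
    for ys by (induction ys) auto
  then show ?thesis
    using xs by (metis sum_bound_def sum_list_distinct_conv_sum_set xs_def)
qed

lemma eval_bound_mono:
  assumes "b \<in> bounds V" and "\<And>v. v \<in> V \<Longrightarrow> s v \<le> s' v"
  shows "eval_bound s b \<le> eval_bound s' b"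
  using assms(1)
proof induction
  case (BExp k b)
  then have "enn2real (eval_bound s b) \<le> enn2real (eval_bound s' b)"
    if "eval_bound s' b \<noteq> \<infinity>"
    using that by (intro enn2real_mono) (auto simp: top.not_eq_extremum)
  with BExp show ?case
    by (auto simp: top_unique intro!: ennreal_leI powr_mono)
next
  case (BLog k b)
  then have "enn2real (eval_bound s b) \<le> enn2real (eval_bound s' b)"
    if "eval_bound s' b \<noteq> \<infinity>"
    using that by (intro enn2real_mono) (auto simp: top.not_eq_extremum)
  with BLog show ?case
    by (fastforce simp: top_unique intro!: ennreal_leI)
qed (auto intro: assms(2) add_mono mult_mono simp: le_max_iff_disj)


section \<open>Integer programs\<close>

text \<open>Multivariate integer polynomials: monomials are finitely supported exponent vectors.\<close>

type_synonym 'v ipoly = "('v \<Rightarrow>\<^sub>0 nat) \<Rightarrow>\<^sub>0 int"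

definition poly_vars :: "'v ipoly \<Rightarrow> 'v set" where
  "poly_vars p = (\<Union>m\<in>Poly_Mapping.keys p. Poly_Mapping.keys m)"

definition eval_poly :: "('v \<Rightarrow> int) \<Rightarrow> 'v ipoly \<Rightarrow> int" where
  "eval_poly \<sigma> p = (\<Sum>m\<in>Poly_Mapping.keys p.
    Poly_Mapping.lookup p m * (\<Prod>v\<in>Poly_Mapping.keys m. \<sigma> v ^ Poly_Mapping.lookup m v))"

datatype 'v guard =
    GLess "'v ipoly" "'v ipoly"
  | GAnd "'v guard" "'v guard"
  | GOr "'v guard" "'v guard"

primrec guard_vars :: "'v guard \<Rightarrow> 'v set" where
  "guard_vars (GLess p q) = poly_vars p \<union> poly_vars q"
| "guard_vars (GAnd \<phi> \<psi>) = guard_vars \<phi> \<union> guard_vars \<psi>"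
| "guard_vars (GOr \<phi> \<psi>) = guard_vars \<phi> \<union> guard_vars \<psi>"

primrec eval_guard :: "('v \<Rightarrow> int) \<Rightarrow> 'v guard \<Rightarrow> bool" where
  "eval_guard \<sigma> (GLess p q) \<longleftrightarrow> eval_poly \<sigma> p < eval_poly \<sigma> q"
| "eval_guard \<sigma> (GAnd \<phi> \<psi>) \<longleftrightarrow> eval_guard \<sigma> \<phi> \<and> eval_guard \<sigma> \<psi>"
| "eval_guard \<sigma> (GOr \<phi> \<psi>) \<longleftrightarrow> eval_guard \<sigma> \<phi> \<or> eval_guard \<sigma> \<psi>"

type_synonym ('v, 'l) transition = "'l \<times> 'v guard \<times> ('v \<Rightarrow> 'v ipoly) \<times> 'l"

definition source :: "('v, 'l) transition \<Rightarrow> 'l" where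
  "source t = fst t"

definition target :: "('v, 'l) transition \<Rightarrow> 'l" where
  "target t = snd (snd (snd t))"

record ('v, 'l) program =
  pvars :: "'v set"
  tvars :: "'v set"
  locs :: "'l set"
  init :: 'l
  transitions :: "('v, 'l) transition set"

definition integer_program :: "('v, 'l) program \<Rightarrow> bool" where
  "integer_program P \<longleftrightarrow>
    finite (pvars P) \<and> finite (tvars P) \<and> pvars P \<inter> tvars P = {} \<and>
    finite (locs P) \<and> init P \<in> locs P \<and> finite (transitions P) \<and>
    (\<forall>(l, \<phi>, \<eta>, l') \<in> transitions P.
      l \<in> locs P \<and> l' \<in> locs P \<and> l' \<noteq> init P \<and>
      guard_vars \<phi> \<subseteq> pvars P \<union> tvars P \<and>
      \<eta> \<in> pvars P \<rightarrow>\<^sub>E {p. poly_vars p \<subseteq> pvars P \<union> tvars P})"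

definition init_trans :: "('v, 'l) program \<Rightarrow> ('v, 'l) transition set" where
  "init_trans P = {t \<in> transitions P. source t = init P}"

definition states :: "('v, 'l) program \<Rightarrow> ('v \<Rightarrow> int) set" where
  "states P = (pvars P \<union> tvars P) \<rightarrow>\<^sub>E UNIV"

definition abs_state :: "('v \<Rightarrow> int) \<Rightarrow> 'v \<Rightarrow> ennreal" where
  "abs_state \<sigma> v = ennreal (real_of_int \<bar>\<sigma> v\<bar>)"

type_synonym ('v, 'l) config = "'l \<times> ('v \<Rightarrow> int)"

definition step :: "('v, 'l) program \<Rightarrow> ('v, 'l) transition \<Rightarrow> ('v, 'l) config rel" where
  "step P t = {((l, \<sigma>), (l', \<sigma>')) | l \<sigma> l' \<sigma>'. \<exists>\<phi> \<eta>. t = (l, \<phi>, \<eta>, l') \<and>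
     \<sigma> \<in> states P \<and> \<sigma>' \<in> states P \<and> eval_guard \<sigma> \<phi> \<and>
     (\<forall>v\<in>pvars P. \<sigma>' v = eval_poly \<sigma> (\<eta> v))}"

definition steps :: "('v, 'l) program \<Rightarrow> ('v, 'l) transition set \<Rightarrow> ('v, 'l) config rel" where
  "steps P S = (\<Union>t\<in>S. step P t)"


section \<open>Runtime and size bounds\<close>

definition is_global_runtime_bound ::
  "('v, 'l) program \<Rightarrow> (('v, 'l) transition \<Rightarrow> 'v bound) \<Rightarrow> bool" where
  "is_global_runtime_bound P RB \<longleftrightarrow>
    (\<forall>t\<in>transitions P. RB t \<in> bounds (pvars P)) \<and>
    (\<forall>t\<in>transitions P. \<forall>\<sigma>\<^sub>0\<in>states P.
      eval_bound (abs_state \<sigma>\<^sub>0) (RB t) \<ge>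
        (SUP k \<in> {k :: nat. \<exists>l' \<sigma>'.
            ((init P, \<sigma>\<^sub>0), (l', \<sigma>')) \<in> ((steps P (transitions P))\<^sup>* O step P t) ^^ k}. of_nat k))"

definition is_size_bound ::
  "('v, 'l) program \<Rightarrow> (('v, 'l) transition \<times> 'v \<Rightarrow> 'v bound) \<Rightarrow> bool" where
  "is_size_bound P SB \<longleftrightarrow>
    (\<forall>t\<in>transitions P. \<forall>v\<in>pvars P. SB (t, v) \<in> bounds (pvars P)) \<and>
    (\<forall>t\<in>transitions P. \<forall>v\<in>pvars P. \<forall>\<sigma>\<^sub>0\<in>states P.
      eval_bound (abs_state \<sigma>\<^sub>0) (SB (t, v)) \<ge>
        Sup {abs_state \<sigma>' v | \<sigma>'. \<exists>l'.
            ((init P, \<sigma>\<^sub>0), (l', \<sigma>')) \<in> (steps P (transitions P))\<^sup>* O step P t})"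

definition entry_trans ::
  "('v, 'l) program \<Rightarrow> ('v, 'l) transition set \<Rightarrow> ('v, 'l) transition set" where
  "entry_trans P T' = {t \<in> transitions P - T'. \<exists>t'\<in>T'. source t' = target t}"

definition is_local_runtime_bound ::
  "('v, 'l) program \<Rightarrow> ('v, 'l) transition set \<Rightarrow> ('v, 'l) transition set \<Rightarrow>
    (('v, 'l) transition \<Rightarrow> 'v bound) \<Rightarrow> bool" where
  "is_local_runtime_bound P T_gt T' f \<longleftrightarrow>
    (\<forall>r\<in>entry_trans P T'. f r \<in> bounds (pvars P)) \<and>
    (\<forall>t\<in>T_gt. \<forall>r\<in>entry_trans P T'. \<forall>\<sigma>\<in>states P.
      eval_bound (abs_state \<sigma>) (f r) \<ge>
        (SUP k \<in> {k :: nat. \<exists>\<sigma>' l'' \<sigma>''.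
            ((source r, \<sigma>'), (target r, \<sigma>)) \<in> step P r \<and>
            ((target r, \<sigma>), (l'', \<sigma>'')) \<in> ((steps P T')\<^sup>* O step P t) ^^ k}. of_nat k))"

end

theory Submission
  imports Defs
begin

text \<open>
  Every run from the initial location splits into maximal blocks of transitions in \<open>T'\<close>.
  As no transition of \<open>T'\<close> starts in the initial location, each block is directly preceded by
  an entry transition \<open>r\<close>. At most \<open>RB r\<close> blocks are entered by \<open>r\<close>, and a block that starts
  in a state \<open>\<sigma>\<close> contains at most \<open>|\<sigma>|(f r)\<close> occurrences of \<open>t\<close>. The size bound
  and monotonicity of \<open>f r\<close> express the latter in terms of the initial state.
\<close>

section \<open>Substitution and finite sums of bounds\<close>

lemma eval_subst_bound:
  "eval_bound s (subst_bound b \<theta>) = eval_bound (\<lambda>v. eval_bound s (\<theta> v)) b"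
  by (induction b) auto

lemma subst_bound_in_bounds:
  assumes "b \<in> bounds V" and "\<And>v. v \<in> V \<Longrightarrow> \<theta> v \<in> bounds W"
  shows "subst_bound b \<theta> \<in> bounds W"
  using assms(1) by induction (auto intro: bounds.intros assms(2))

lemma sum_bound_in_bounds:
  assumes "finite A" and "\<And>a. a \<in> A \<Longrightarrow> g a \<in> bounds V"
  shows "sum_bound g A \<in> bounds V"
proof -
  define xs where "xs = (SOME xs. distinct xs \<and> set xs = A)"
  have "\<exists>xs. distinct xs \<and> set xs = A"
    using finite_distinct_list[OF assms(1)] by blast
  then have "distinct xs \<and> set xs = A"
    unfolding xs_def by (rule someI_ex)
  then have "\<And>a. a \<in> set xs \<Longrightarrow> g a \<in> bounds V"
    using assms(2) by blast
  then have "foldr (\<lambda>a b. BAdd (g a) b) xs (BConst 0) \<in> bounds V"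
    by (induction xs) (auto intro: bounds.intros)
  then show ?thesis
    by (simp add: sum_bound_def xs_def)
qed

section \<open>Runs as sequences of transitions\<close>

text \<open>
  Distinct transitions may relate the same configurations, so occurrences of a transition can
  only be counted in the sequence of transitions of a run.
\<close>

primrec run :: "('v, 'l) program \<Rightarrow> ('v, 'l) transition list \<Rightarrow> ('v, 'l) config rel" where
  "run P [] = Id"
| "run P (t # ts) = step P t O run P ts"

lemma run_append: "run P (ts @ us) = run P ts O run P us"
  by (induction ts) (auto simp: O_assoc)

lemma run_subset_steps:
  assumes "set ts \<subseteq> S"
  shows "run P ts \<subseteq> (steps P S)\<^sup>*"
  using assms
proof (induction ts)
  case (Cons t ts)
  then have "step P t \<subseteq> steps P S" "run P ts \<subseteq> (steps P S)\<^sup>*"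
    by (auto simp: steps_def)
  then show ?case
    by (fastforce intro: converse_rtrancl_into_rtrancl)
qed auto

lemma steps_imp_run:
  assumes "(c, d) \<in> (steps P S)\<^sup>*"
  obtains ts where "set ts \<subseteq> S" "(c, d) \<in> run P ts"
proof -
  from assms have "\<exists>ts. set ts \<subseteq> S \<and> (c, d) \<in> run P ts"
  proof (induction rule: converse_rtrancl_induct)
    case base
    show ?case
      by (rule exI[of _ "[]"]) auto
  next
    case (step b c)
    then obtain t ts where "t \<in> S" "(b, c) \<in> step P t" "set ts \<subseteq> S" "(c, d) \<in> run P ts"
      by (auto simp: steps_def)
    then show ?case
      by (intro exI[of _ "t # ts"]) auto
  qed
  then show thesis
    using that by blast
qed

text \<open>Cut the run after each occurrence of \<open>t\<close>: every piece is one factor of the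
  power. Whatever follows the last occurrence is dropped, so the end point is some \<open>e\<close>
  and not \<open>d\<close>.\<close>

lemma run_imp_relpow:
  assumes "set ts \<subseteq> S" and "(c, d) \<in> run P ts"
  shows "\<exists>e. (c, e) \<in> ((steps P S)\<^sup>* O step P t) ^^ count_list ts t"
  using assms
proof (induction ts arbitrary: c)
  case (Cons u us)
  let ?R = "(steps P S)\<^sup>* O step P t"
  from Cons.prems obtain b where b: "(c, b) \<in> step P u" "(b, d) \<in> run P us"
    by auto
  from Cons.IH[OF _ b(2)] Cons.prems(1) obtain e where e: "(b, e) \<in> ?R ^^ count_list us t"
    by auto
  show ?case
  proof (cases "u = t")
    case True
    with b have "(c, b) \<in> ?R"
      by auto
    from relpow_Suc_I2[OF this e] True show ?thesis
      by (intro exI[of _ e]) simp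
  next
    case False
    show ?thesis
    proof (cases "count_list us t")
      case 0
      \<comment> \<open>Without any \<open>t\<close> the exponent is 0, and \<open>c\<close> itself
        is the end point.\<close>
      with False show ?thesis
        by auto
    next
      case (Suc m)
      with e obtain a where a: "(b, a) \<in> ?R" "(a, e) \<in> ?R ^^ m"
        by (metis relpow_Suc_D2)
      have "(c, b) \<in> steps P S"
        using b Cons.prems by (auto simp: steps_def)
      \<comment> \<open>A leading step other than \<open>t\<close> is absorbed into the closure of
        the first factor.\<close>
      with a(1) have "(c, a) \<in> ?R"
        by (auto intro: converse_rtrancl_into_rtrancl)
      from relpow_Suc_I2[OF this a(2)] False Suc show ?thesis
        by (intro exI[of _ e]) simp
    qed
  qed
qed auto

text \<open>The stretches between the counted steps may themselves use \<open>t\<close>, hence only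
  an inequality for the count. The assumption \<open>t \<in> S\<close> keeps the counted steps
  within \<open>S\<close>.\<close>

lemma relpow_imp_run:
  assumes "t \<in> S" and "(c, d) \<in> ((steps P S)\<^sup>* O step P t) ^^ k"
  obtains ts where "set ts \<subseteq> S" "(c, d) \<in> run P ts" "k \<le> count_list ts t"
proof -
  from assms(2) have "\<exists>ts. set ts \<subseteq> S \<and> (c, d) \<in> run P ts \<and> k \<le> count_list ts t"
  proof (induction k arbitrary: d)
    case 0
    then show ?case
      by (intro exI[of _ "[]"]) auto
  next
    case (Suc k)
    then obtain a b where
      a: "(c, a) \<in> ((steps P S)\<^sup>* O step P t) ^^ k" and
      b: "(a, b) \<in> (steps P S)\<^sup>*" "(b, d) \<in> step P t"
      by auto
    from Suc.IH[OF a] obtain ts where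
      "set ts \<subseteq> S" "(c, a) \<in> run P ts" "k \<le> count_list ts t"
      by blast
    moreover obtain us where "set us \<subseteq> S" "(a, b) \<in> run P us"
      using b(1) by (rule steps_imp_run)
    ultimately show ?case
      using b(2) assms(1)
      by (intro exI[of _ "ts @ us @ [t]"]) (auto simp: run_append)
  qed
  then show thesis
    using that by blast
qed

lemma stepD:
  assumes "(c, d) \<in> step P t"
  shows "fst c = source t" "fst d = target t" "snd d \<in> states P"
  using assms by (auto simp: step_def source_def target_def)

section \<open>The given bounds, read off a single run\<close>

text \<open>By \<open>run_imp_relpow\<close>, the number of occurrences of \<open>t\<close> in a run
  is one of the values \<open>k\<close> under the supremum.\<close>

lemma global_runtime_bound_count:
  assumes "is_global_runtime_bound P RB" and "t \<in> transitions P" and "\<sigma>\<^sub>0 \<in> states P"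
    and "set ts \<subseteq> transitions P" and "((init P, \<sigma>\<^sub>0), d) \<in> run P ts"
  shows "of_nat (count_list ts t) \<le> eval_bound (abs_state \<sigma>\<^sub>0) (RB t)"
proof -
  obtain l' \<sigma>' where "((init P, \<sigma>\<^sub>0), (l', \<sigma>')) \<in>
      ((steps P (transitions P))\<^sup>* O step P t) ^^ count_list ts t"
    using run_imp_relpow[OF assms(4,5)] by (metis surj_pair)
  then have "of_nat (count_list ts t) \<le> (SUP k \<in> {k :: nat. \<exists>l' \<sigma>'.
      ((init P, \<sigma>\<^sub>0), (l', \<sigma>')) \<in> ((steps P (transitions P))\<^sup>* O step P t) ^^ k}. of_nat k :: ennreal)"
    by (intro SUP_upper) blast
  also have "\<dots> \<le> eval_bound (abs_state \<sigma>\<^sub>0) (RB t)"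
    using assms(1-3) by (simp add: is_global_runtime_bound_def)
  finally show ?thesis .
qed

lemma size_bound_run:
  assumes "is_size_bound P SB" and "t \<in> transitions P" and "v \<in> pvars P" and "\<sigma>\<^sub>0 \<in> states P"
    and "set ts \<subseteq> transitions P" and "((init P, \<sigma>\<^sub>0), c) \<in> run P ts" and "(c, d) \<in> step P t"
  shows "abs_state (snd d) v \<le> eval_bound (abs_state \<sigma>\<^sub>0) (SB (t, v))"
proof -
  have "((init P, \<sigma>\<^sub>0), (fst d, snd d)) \<in> (steps P (transitions P))\<^sup>* O step P t"
    using run_subset_steps[OF assms(5)] assms(6,7) by auto
  then have "abs_state (snd d) v \<le> Sup {abs_state \<sigma>' v | \<sigma>'. \<exists>l'.
      ((init P, \<sigma>\<^sub>0), (l', \<sigma>')) \<in> (steps P (transitions P))\<^sup>* O step P t}"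
    by (intro Sup_upper) blast
  also have "\<dots> \<le> eval_bound (abs_state \<sigma>\<^sub>0) (SB (t, v))"
    using assms(1-4) by (simp add: is_size_bound_def)
  finally show ?thesis .
qed

lemma local_runtime_bound_count:
  assumes "is_local_runtime_bound P T_gt T' f" and "t \<in> T_gt" and "r \<in> entry_trans P T'"
    and "set ts \<subseteq> T'" and "(c, d) \<in> step P r" and "(d, e) \<in> run P ts"
  shows "of_nat (count_list ts t) \<le> eval_bound (abs_state (snd d)) (f r)"
proof -
  obtain \<sigma>' where c: "c = (source r, \<sigma>')"
    using stepD(1)[OF assms(5)] by (metis prod.collapse)
  obtain \<sigma> where d: "d = (target r, \<sigma>)"
    using stepD(2)[OF assms(5)] by (metis prod.collapse)
  have \<sigma>: "\<sigma> \<in> states P"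
    using stepD(3)[OF assms(5)] d by simp
  obtain l'' \<sigma>'' where "((target r, \<sigma>), (l'', \<sigma>'')) \<in> ((steps P T')\<^sup>* O step P t) ^^ count_list ts t"
    using run_imp_relpow[OF assms(4,6)] d by (metis surj_pair)
  then have "of_nat (count_list ts t) \<le> (SUP k \<in> {k :: nat. \<exists>\<sigma>' l'' \<sigma>''.
      ((source r, \<sigma>'), (target r, \<sigma>)) \<in> step P r \<and>
      ((target r, \<sigma>), (l'', \<sigma>'')) \<in> ((steps P T')\<^sup>* O step P t) ^^ k}. of_nat k :: ennreal)"
    using assms(5) c d by (intro SUP_upper) blast
  also have "\<dots> \<le> eval_bound (abs_state \<sigma>) (f r)"
    using assms(1-3) \<sigma> by (simp add: is_local_runtime_bound_def)
  finally show ?thesis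
    by (simp add: d)
qed

text \<open>The state in which the block starts is bounded variable by variable by
  \<open>SB\<close>, and \<open>f r\<close> is monotone. The resulting bound no longer depends on
  that state, so it serves for all blocks entered by \<open>r\<close>.\<close>

lemma entry_count_bound:
  assumes "is_size_bound P SB" and "is_local_runtime_bound P T_gt T' f" and "t \<in> T_gt"
    and "r \<in> entry_trans P T'" and "\<sigma>\<^sub>0 \<in> states P"
    and "set us \<subseteq> transitions P" and "((init P, \<sigma>\<^sub>0), c) \<in> run P us" and "(c, d) \<in> step P r"
    and "set vs \<subseteq> T'" and "(d, e) \<in> run P vs"
  shows "of_nat (count_list vs t) \<le>
    eval_bound (abs_state \<sigma>\<^sub>0) (subst_bound (f r) (\<lambda>v. SB (r, v)))"
proof -
  have r: "r \<in> transitions P"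
    using assms(4) by (simp add: entry_trans_def)
  have "of_nat (count_list vs t) \<le> eval_bound (abs_state (snd d)) (f r)"
    by (rule local_runtime_bound_count[OF assms(2-4,9,8,10)])
  also have "\<dots> \<le> eval_bound (\<lambda>v. eval_bound (abs_state \<sigma>\<^sub>0) (SB (r, v))) (f r)"
  proof (rule eval_bound_mono)
    show "f r \<in> bounds (pvars P)"
      using assms(2,4) by (simp add: is_local_runtime_bound_def)
  qed (rule size_bound_run[OF assms(1) r _ assms(5-8)])
  finally show ?thesis
    by (simp add: eval_subst_bound)
qed

section \<open>Decomposition into blocks and counting\<close>

text \<open>With \<open>A = T'\<close> this isolates the last block of a run; the last element of
  \<open>us\<close> is where \<open>dropWhile\<close> stops on the reversed list.\<close>

lemma split_maximal_suffix:
  obtains us vs where "ts = us @ vs" "set vs \<subseteq> A" "us = [] \<or> last us \<notin> A"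
proof
  let ?vs = "takeWhile (\<lambda>x. x \<in> A) (rev ts)" and ?us = "dropWhile (\<lambda>x. x \<in> A) (rev ts)"
  show "ts = rev ?us @ rev ?vs"
    by (simp flip: rev_append)
  show "set (rev ?vs) \<subseteq> A"
    by (auto dest: set_takeWhileD)
  show "rev ?us = [] \<or> last (rev ?us) \<notin> A"
    using hd_dropWhile[of "\<lambda>x. x \<in> A" "rev ts"] by (auto simp: last_rev)
qed

text \<open>Induction on the length of the run: each step removes the last block together with the
  transition before it. \<open>F r\<close> abstracts a bound on the occurrences of \<open>t\<close>
  in any one block entered by \<open>r\<close>.\<close>

lemma count_le_sum_entry_counts:
  fixes F :: "('v, 'l) transition \<Rightarrow> ennreal"
  assumes fin: "finite (entry_trans P T')" and T': "T' \<subseteq> transitions P - init_trans P"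
    and t: "t \<in> T'"
    and block: "\<And>us c r d vs e. r \<in> entry_trans P T' \<Longrightarrow> set us \<subseteq> transitions P \<Longrightarrow>
      ((init P, \<sigma>\<^sub>0), c) \<in> run P us \<Longrightarrow> (c, d) \<in> step P r \<Longrightarrow> set vs \<subseteq> T' \<Longrightarrow>
      (d, e) \<in> run P vs \<Longrightarrow> of_nat (count_list vs t) \<le> F r"
    and "set ts \<subseteq> transitions P" and "((init P, \<sigma>\<^sub>0), e) \<in> run P ts"
  shows "of_nat (count_list ts t) \<le> (\<Sum>r\<in>entry_trans P T'. of_nat (count_list ts r) * F r)"
  using assms(5,6)
proof (induction ts arbitrary: e rule: measure_induct_rule[of length])
  case (less ts)
  let ?E = "entry_trans P T'"
  let ?sum = "\<lambda>ts. \<Sum>r\<in>?E. of_nat (count_list ts r) * F r"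
  obtain us vs where ts: "ts = us @ vs" and vs: "set vs \<subseteq> T'" and us: "us = [] \<or> last us \<notin> T'"
    by (rule split_maximal_suffix)
  obtain d where d: "((init P, \<sigma>\<^sub>0), d) \<in> run P us" "(d, e) \<in> run P vs"
    using less.prems(2) by (auto simp: ts run_append)
  have source_vs: "x \<in> T' \<and> source x = fst d" if vs_eq: "vs = x # xs" for x xs
  proof -
    obtain d' where "(d, d') \<in> step P x"
      using d(2) vs_eq by auto
    from stepD(1)[OF this] vs vs_eq show ?thesis
      by simp
  qed
  show ?case
  proof (cases us rule: rev_cases)
    case Nil
    \<comment> \<open>A block at the very beginning would start in the initial location, which no
      transition of \<open>T'\<close> does; so the whole run is empty.\<close>
    then have "fst d = init P"
      using d(1) by auto
    with source_vs T' have "vs = []"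
      by (cases vs) (auto simp: init_trans_def)
    with Nil ts show ?thesis
      by simp
  next
    case (snoc ws r)
    obtain c where c: "((init P, \<sigma>\<^sub>0), c) \<in> run P ws" "(c, d) \<in> step P r"
      using d(1) by (auto simp: snoc run_append)
    have r: "r \<in> transitions P" "r \<notin> T'" and ws: "set ws \<subseteq> transitions P"
      using us less.prems(1) by (auto simp: snoc ts)
    have IH: "of_nat (count_list ws t) \<le> ?sum ws"
      using less.IH[OF _ ws c(1)] by (simp add: ts snoc)
    \<comment> \<open>\<open>r\<close> differs from \<open>t\<close>, since only \<open>t\<close>
      lies in \<open>T'\<close>.\<close>
    have count: "count_list ts t = count_list ws t + count_list vs t"
      using r t by (auto simp: ts snoc)
    show ?thesis
    proof (cases vs)
      case Nil
      \<comment> \<open>Here \<open>r\<close> need not be an entry transition, but then nothing has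
        to be charged to it.\<close>
      then have "of_nat (count_list ts t) \<le> ?sum ws"
        using IH count by simp
      also have "\<dots> \<le> ?sum ts"
        by (intro sum_mono mult_right_mono) (auto simp: ts snoc)
      finally show ?thesis .
    next
      case (Cons x xs)
      \<comment> \<open>The first transition \<open>x\<close> of the block witnesses that
        \<open>T'\<close> has a transition starting in the target of \<open>r\<close>.\<close>
      have E: "r \<in> ?E"
        using source_vs[OF Cons] stepD(2)[OF c(2)] r by (auto simp: entry_trans_def)
      have "of_nat (count_list ts t) \<le> ?sum ws + F r"
        unfolding count of_nat_add
        by (intro add_mono IH block[OF E ws c vs d(2)])
      \<comment> \<open>Written as the sum for the one-element list, \<open>F r\<close> can be added
        to \<open>?sum ws\<close> term by term.\<close>
      also have "F r = (\<Sum>s\<in>?E. of_nat (count_list [r] s) * F s)"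
        using fin E by (subst sum.remove[of _ r]) (auto intro!: sum.neutral)
      also have "?sum ws + \<dots> = (\<Sum>s\<in>?E. of_nat (count_list (ws @ [r]) s) * F s)"
        by (simp only: sum.distrib[symmetric] distrib_right[symmetric] of_nat_add[symmetric]
            count_list_append)
      also have "\<dots> \<le> ?sum ts"
        by (intro sum_mono mult_right_mono) (auto simp: ts snoc)
      finally show ?thesis .
    qed
  qed
qed

section \<open>The new global runtime bound\<close>

theorem theorem6:
  fixes P :: "('v, 'l) program"
    and RB RB' f :: "('v, 'l) transition \<Rightarrow> 'v bound"
    and SB :: "('v, 'l) transition \<times> 'v \<Rightarrow> 'v bound"
    and T_gt T' :: "('v, 'l) transition set"
  assumes "integer_program P"
    and "is_global_runtime_bound P RB"
    and "is_size_bound P SB"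
    and "T_gt \<noteq> {}" and "T_gt \<subseteq> T'" and "T' \<subseteq> transitions P - init_trans P"
    and "is_local_runtime_bound P T_gt T' f"
    and "\<And>t. t \<in> transitions P - T_gt \<Longrightarrow> RB' t = RB t"
    and "\<And>t. t \<in> T_gt \<Longrightarrow>
      RB' t = sum_bound (\<lambda>r. BMult (RB r) (subst_bound (f r) (\<lambda>v. SB (r, v)))) (entry_trans P T')"
  shows "is_global_runtime_bound P RB'"
  unfolding is_global_runtime_bound_def
proof (intro conjI ballI)
  let ?E = "entry_trans P T'"
  let ?b = "\<lambda>r. subst_bound (f r) (\<lambda>v. SB (r, v))"
  have E: "?E \<subseteq> transitions P"
    by (auto simp: entry_trans_def)
  moreover have "finite (transitions P)"
    using assms(1) by (simp add: integer_program_def)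
  ultimately have fin: "finite ?E"
    by (rule finite_subset)
  fix t assume t: "t \<in> transitions P"
  show "RB' t \<in> bounds (pvars P)"
  proof (cases "t \<in> T_gt")
    case True
    have "BMult (RB r) (?b r) \<in> bounds (pvars P)" if "r \<in> ?E" for r
    proof (rule bounds.BMult)
      show "RB r \<in> bounds (pvars P)"
        using assms(2) E that by (auto simp: is_global_runtime_bound_def)
      show "?b r \<in> bounds (pvars P)"
      proof (rule subst_bound_in_bounds)
        show "f r \<in> bounds (pvars P)"
          using assms(7) that by (simp add: is_local_runtime_bound_def)
        show "SB (r, v) \<in> bounds (pvars P)" if "v \<in> pvars P" for v
          using assms(3) E \<open>r \<in> ?E\<close> that by (auto simp: is_size_bound_def)
      qed
    qed
    with fin show ?thesis
      unfolding assms(9)[OF True] by (rule sum_bound_in_bounds)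
  next
    case False
    with assms(2,8) t show ?thesis
      by (simp add: is_global_runtime_bound_def)
  qed
  fix \<sigma>\<^sub>0 assume \<sigma>\<^sub>0: "\<sigma>\<^sub>0 \<in> states P"
  let ?ev = "eval_bound (abs_state \<sigma>\<^sub>0)"
  show "(SUP k \<in> {k :: nat. \<exists>l' \<sigma>'. ((init P, \<sigma>\<^sub>0), (l', \<sigma>')) \<in>
      ((steps P (transitions P))\<^sup>* O step P t) ^^ k}. of_nat k) \<le> ?ev (RB' t)"
  proof (cases "t \<in> T_gt")
    case True
    show ?thesis
    proof (rule SUP_least, clarify)
      fix k l' \<sigma>'
      assume "((init P, \<sigma>\<^sub>0), (l', \<sigma>')) \<in> ((steps P (transitions P))\<^sup>* O step P t) ^^ k"
      with t obtain ts where ts: "set ts \<subseteq> transitions P"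
        "((init P, \<sigma>\<^sub>0), (l', \<sigma>')) \<in> run P ts" and k: "k \<le> count_list ts t"
        by (rule relpow_imp_run)
      from True assms(5) have "t \<in> T'"
        by blast
      have "of_nat k \<le> (of_nat (count_list ts t) :: ennreal)"
        using k by simp
      \<comment> \<open>\<open>F r\<close> is taken to be the value of the substituted local bound
        in the initial state.\<close>
      also have "\<dots> \<le> (\<Sum>r\<in>?E. of_nat (count_list ts r) * ?ev (?b r))"
        using fin assms(6) \<open>t \<in> T'\<close> _ ts
        by (rule count_le_sum_entry_counts)
          (rule entry_count_bound[OF assms(3,7) True _ \<sigma>\<^sub>0])
      \<comment> \<open>The same run \<open>ts\<close> contains each entry transition
        \<open>r\<close> at most \<open>RB r\<close> times.\<close>
      also have "\<dots> \<le> (\<Sum>r\<in>?E. ?ev (RB r) * ?ev (?b r))"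
        using E by (intro sum_mono mult_right_mono
            global_runtime_bound_count[OF assms(2) _ \<sigma>\<^sub>0 ts]) auto
      also have "\<dots> = ?ev (RB' t)"
        unfolding assms(9)[OF True] by (simp add: eval_sum_bound[OF fin])
      finally show "of_nat k \<le> ?ev (RB' t)" .
    qed
  next
    case False
    with assms(2,8) t \<sigma>\<^sub>0 show ?thesis
      by (simp add: is_global_runtime_bound_def)
  qed
qed

end
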